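(* Let $h\ge 1$ be an integer and let $(c_k)_{k\ge 0}$ be a sequence of positive reals. Let $(\pi_k)_{k\ge 0}$ be a sequence of policies generated from $\pi_0\in \mathrm{ri}(\Pi)$ by the exact $h$-PMD update $$\pi_{k+1} = \arg\max_{\pi\in\Pi}\left\{\eta_k\, \mathcal{T}^{\pi}\mathcal{T}^{h-1}V^{\pi_k} - D_\phi(\pi,\pi_k)\right\},\qquad k\ge 0,$$ with positive stepsizes satisfying $\eta_k \ge \frac{1}{c_k}\left\| \min_{\pi\in\mathcal{G}_h(V^{\pi_k})} D_\phi(\pi,\pi_k)\right\|_\infty$ for every $k$, the minimum being computed component-wise (state by state). Then for every $k\in\mathbb{N}$, $$\|V^\star - V^{\pi_k}\|_\infty \le \gamma^{hk}\left(\|V^\star - V^{\pi_0}\|_\infty + \frac{1}{1-\gamma}\sum_{t=1}^{k}\frac{c_{t-1}}{\gamma^{ht}}\right).$$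
   Context: Setting: a discounted Markov decision process with finite state set $\mathcal{S}$ ($S=|\mathcal{S}|$), finite action set $\mathcal{A}$ ($A=|\mathcal{A}|$), transition kernel $P:\mathcal{S}\times\mathcal{A}\to\Delta(\mathcal{S})$ ($\Delta(\mathcal X)$ is the probability simplex over $\mathcal X$), reward $r:\mathcal{S}\times\mathcal{A}\to[0,1]$, discount $\gamma\in(0,1)$. $\Pi$ is the set of policies $\pi:\mathcal{S}\to\Delta(\mathcal{A})$, $\pi_s:=\pi(\cdot|s)$ (and $\pi^k_s:=\pi_k(\cdot|s)$); $\mathrm{ri}$ denotes relative interior. $V^\pi(s)=\mathbb{E}_\pi[\sum_{t\ge0}\gamma^t r(s_t,a_t)\mid s_0=s]$ and $V^\star$ is the optimal value function ($V^\star(s)=\max_\pi V^\pi(s)$). Operators: for $V\in\mathbb{R}^S$, $(PV)(s,a)=\sum_{s'}P(s'|s,a)V(s')$; $(\mathcal{T}^\pi V)(s)=\sum_a\pi(a|s)\,(r(s,a)+\gamma (PV)(s,a))$; $(\mathcal{T}V)(s)=\max_a (r(s,a)+\gamma (PV)(s,a))$. $\mathcal{T}^{h-1}$ is the $(h-1)$-fold iterate of $\mathcal{T}$. The set of $h$-step greedy policies is $\mathcal{G}_h(V)=\{\pi\in\Pi:\mathcal{T}^\pi\mathcal{T}^{h-1}V=\mathcal{T}^hV\}$. $\|\cdot\|_\infty$ is the max norm. Mirror map: $\phi:\mathrm{dom}\,\phi\to\mathbb{R}$ is of Legendre type (strictly convex and essentially smooth in the relative interior of its domain) with $\Delta(\mathcal{A})\subset\mathrm{dom}\,\phi$.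 Its Bregman divergence is $D_\phi(p,q)=\phi(p)-\phi(q)-\langle\nabla\phi(q),p-q\rangle$, for $p\in\mathrm{dom}\,\phi$ and $q\in\mathrm{ri}(\mathrm{dom}\,\phi)$ (where $\nabla\phi$ exists); being generated by the algorithm includes that all divergences involved are defined. For policies, $D_\phi(\pi,\pi')\in\mathbb{R}^S$ is the vector with components $D_\phi(\pi_s,\pi'_s)$. The $\arg\max$ over $\Pi$ of an $\mathbb{R}^S$-valued expression is taken separately for each state component $s$ (component $s$ depends only on $\pi_s$). *)

theory Defs
  imports "HOL-Analysis.Analysis" "HOL-Probability.Probability"
begin

section \<open>Policies\<close>

definition prob_simplex :: "(real ^ 'n::finite) set" where
  "prob_simplex = {p. (\<forall>i. 0 \<le> p $ i) \<and> (\<Sum>i\<in>UNIV. p $ i) = 1}"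

text \<open>
  A policy is a point of the Euclidean space of state-action vectors, so that the relative
  interior of the policy set is the one of the library; \<open>\<pi> $ s $ a\<close> is the probability of
  action \<open>a\<close> in state \<open>s\<close>.
\<close>

definition policies :: "(real ^ 'a::finite ^ 's::finite) set" where
  "policies = {\<pi>. \<forall>s. \<pi> $ s \<in> prob_simplex}"

section \<open>Value functions\<close>

definition policy_pmf :: "real ^ 'a ^ 's \<Rightarrow> 's::finite \<Rightarrow> 'a::finite pmf" where
  "policy_pmf \<pi> s = embed_pmf (\<lambda>a. \<pi> $ s $ a)"

definition state_action_pmf :: "real ^ 'a ^ 's \<Rightarrow> 's::finite \<Rightarrow> ('s \<times> 'a::finite) pmf" where
  "state_action_pmf \<pi> s = map_pmf (Pair s) (policy_pmf \<pi> s)"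

text \<open>Conditional law of \<open>(s\<^sub>t, a\<^sub>t)\<close> given the history \<open>\<omega>\<close> of state-action pairs before time \<open>t\<close>.\<close>

definition step_kernel ::
  "('s::finite \<Rightarrow> 'a::finite \<Rightarrow> 's pmf) \<Rightarrow> real ^ 'a ^ 's \<Rightarrow> 's \<Rightarrow> nat \<Rightarrow> (nat \<Rightarrow> 's \<times> 'a) \<Rightarrow> ('s \<times> 'a) measure"
where
  "step_kernel P \<pi> s t \<omega> =
     measure_pmf (case t of
         0 \<Rightarrow> state_action_pmf \<pi> s
       | Suc u \<Rightarrow> bind_pmf (P (fst (\<omega> u)) (snd (\<omega> u))) (state_action_pmf \<pi>))"

lemma Ionescu_Tulcea_step_kernel:
  fixes P :: "'s::finite \<Rightarrow> 'a::finite \<Rightarrow> 's pmf"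
  shows "Ionescu_Tulcea (step_kernel P \<pi> s) (\<lambda>_. count_space UNIV)"
proof (rule Ionescu_Tulcea.intro)
  fix t
  show "step_kernel P \<pi> s t \<in> measurable (PiM {0..<t} (\<lambda>_. count_space UNIV)) (subprob_algebra (count_space UNIV))"
  proof (cases t)
    case 0
    then show ?thesis
      by (simp add: step_kernel_def[abs_def] space_subprob_algebra measure_pmf.subprob_space_axioms)
  next
    case (Suc u)
    have "(\<lambda>\<omega>. \<omega> u) \<in> measurable (PiM {0..<t} (\<lambda>_. count_space UNIV)) (count_space (UNIV :: ('s \<times> 'a) set))"
      by (rule measurable_component_singleton) (simp add: Suc)
    moreover have "(\<lambda>x. measure_pmf (bind_pmf (P (fst x) (snd x)) (state_action_pmf \<pi>)))
        \<in> measurable (count_space UNIV) (subprob_algebra (count_space UNIV))"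
      by (simp add: space_subprob_algebra measure_pmf.subprob_space_axioms)
    ultimately show ?thesis
      unfolding step_kernel_def[abs_def] Suc nat.case by (rule measurable_compose)
  qed
next
  fix t and \<omega> :: "nat \<Rightarrow> 's \<times> 'a"
  show "prob_space (step_kernel P \<pi> s t \<omega>)"
    by (simp add: step_kernel_def measure_pmf.prob_space_axioms)
qed

text \<open>
  The law of the trajectory \<open>(s\<^sub>t, a\<^sub>t)\<close>, \<open>t \<ge> 0\<close>, started in \<open>s\<close>: the projective limit given by
  the Ionescu-Tulcea theorem. It lives on the product sigma-algebra over all times.
\<close>

definition trajectory ::
  "('s::finite \<Rightarrow> 'a::finite \<Rightarrow> 's pmf) \<Rightarrow> real ^ 'a ^ 's \<Rightarrow> 's \<Rightarrow> (nat \<Rightarrow> 's \<times> 'a) measure"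
where
  "trajectory P \<pi> s =
     projective_family.lim UNIV
       (Ionescu_Tulcea.CI (step_kernel P \<pi> s) (\<lambda>_. count_space UNIV)) (\<lambda>_. count_space UNIV)"

definition value_fun ::
  "('s::finite \<Rightarrow> 'a::finite \<Rightarrow> 's pmf) \<Rightarrow> ('s \<Rightarrow> 'a \<Rightarrow> real) \<Rightarrow> real \<Rightarrow> real ^ 'a ^ 's \<Rightarrow> real ^ 's"
where
  "value_fun P r \<gamma> \<pi> =
     (\<chi> s. \<integral>\<omega>. (\<Sum>t. \<gamma> ^ t * r (fst (\<omega> t)) (snd (\<omega> t))) \<partial>trajectory P \<pi> s)"

text \<open>The supremum over all policies is attained, so it is the maximum.\<close>

definition opt_value ::
  "('s::finite \<Rightarrow> 'a::finite \<Rightarrow> 's pmf) \<Rightarrow> ('s \<Rightarrow> 'a \<Rightarrow> real) \<Rightarrow> real \<Rightarrow> real ^ 's"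
where
  "opt_value P r \<gamma> = (\<chi> s. SUP \<pi>\<in>policies. value_fun P r \<gamma> \<pi> $ s)"

section \<open>Bellman operators and greedy policies\<close>

definition q_backup ::
  "('s::finite \<Rightarrow> 'a::finite \<Rightarrow> 's pmf) \<Rightarrow> ('s \<Rightarrow> 'a \<Rightarrow> real) \<Rightarrow> real \<Rightarrow> real ^ 's \<Rightarrow> 's \<Rightarrow> 'a \<Rightarrow> real"
where
  "q_backup P r \<gamma> V s a = r s a + \<gamma> * (\<Sum>s'\<in>UNIV. pmf (P s a) s' * V $ s')"

definition bellman_policy ::
  "('s::finite \<Rightarrow> 'a::finite \<Rightarrow> 's pmf) \<Rightarrow> ('s \<Rightarrow> 'a \<Rightarrow> real) \<Rightarrow> real \<Rightarrow> real ^ 'a ^ 's \<Rightarrow> real ^ 's \<Rightarrow> real ^ 's"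
where
  "bellman_policy P r \<gamma> \<pi> V = (\<chi> s. \<Sum>a\<in>UNIV. \<pi> $ s $ a * q_backup P r \<gamma> V s a)"

definition bellman_opt ::
  "('s::finite \<Rightarrow> 'a::finite \<Rightarrow> 's pmf) \<Rightarrow> ('s \<Rightarrow> 'a \<Rightarrow> real) \<Rightarrow> real \<Rightarrow> real ^ 's \<Rightarrow> real ^ 's"
where
  "bellman_opt P r \<gamma> V = (\<chi> s. MAX a\<in>UNIV. q_backup P r \<gamma> V s a)"

definition greedy_policies ::
  "('s::finite \<Rightarrow> 'a::finite \<Rightarrow> 's pmf) \<Rightarrow> ('s \<Rightarrow> 'a \<Rightarrow> real) \<Rightarrow> real \<Rightarrow> nat \<Rightarrow> real ^ 's \<Rightarrow> (real ^ 'a ^ 's) set"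
where
  "greedy_policies P r \<gamma> h V =
     {\<pi> \<in> policies. bellman_policy P r \<gamma> \<pi> ((bellman_opt P r \<gamma> ^^ (h - 1)) V)
                      = (bellman_opt P r \<gamma> ^^ h) V}"

section \<open>Mirror maps and Bregman divergences\<close>

text \<open>
  A mirror map is a pair of its domain \<open>D\<close> and a function \<open>\<phi>\<close> whose values outside \<open>D\<close> are
  irrelevant. The domain may have empty interior (for instance be the simplex itself), so
  the gradient is taken relative to the affine hull of \<open>D\<close>: it is the unique vector parallel to
  the affine hull that represents the derivative of \<open>\<phi>\<close> within \<open>D\<close>. At interior points of \<open>D\<close> it
  is the ordinary gradient.
\<close>

definition rel_gradient :: "'v::euclidean_space set \<Rightarrow> ('v \<Rightarrow> real) \<Rightarrow> 'v \<Rightarrow> 'v" where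
  "rel_gradient D \<phi> q =
     (THE g. g \<in> {x - y | x y. x \<in> affine hull D \<and> y \<in> affine hull D} \<and>
             (\<phi> has_derivative (\<lambda>v. g \<bullet> v)) (at q within D))"

lemma rel_gradient_interior:
  assumes q: "q \<in> interior D" and g: "GDERIV \<phi> q :> g"
  shows "rel_gradient D \<phi> q = g"
proof -
  have at: "at q within D = at q"
    using q by (rule at_within_interior)
  have "affine hull D = UNIV"
    using q affine_hull_nonempty_interior by blast
  then have tangent: "{x - y | x y. x \<in> affine hull D \<and> y \<in> affine hull D} = UNIV"
    by auto (metis diff_zero)
  have der: "(\<phi> has_derivative (\<lambda>v. g \<bullet> v)) (at q)"
    using g by (simp add: gderiv_def inner_commute)
  show ?thesis
    unfolding rel_gradient_def at tangent
  proof (rule the_equality)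
    show "g \<in> UNIV \<and> (\<phi> has_derivative (\<lambda>v. g \<bullet> v)) (at q)"
      using der by simp
  next
    fix g' assume "g' \<in> UNIV \<and> (\<phi> has_derivative (\<lambda>v. g' \<bullet> v)) (at q)"
    then have "(\<lambda>v. g' \<bullet> v) = (\<lambda>v. g \<bullet> v)"
      using der has_derivative_unique by blast
    then show "g' = g"
      by (metis vector_eq_rdot)
  qed
qed

definition strictly_convex_on :: "'v::real_vector set \<Rightarrow> ('v \<Rightarrow> real) \<Rightarrow> bool" where
  "strictly_convex_on C f \<longleftrightarrow>
     (\<forall>x\<in>C. \<forall>y\<in>C. \<forall>u>0. \<forall>v>0. x \<noteq> y \<and> u + v = 1 \<longrightarrow>
        f (u *\<^sub>R x + v *\<^sub>R y) < u * f x + v * f y)"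

definition essentially_smooth :: "'v::euclidean_space set \<Rightarrow> ('v \<Rightarrow> real) \<Rightarrow> bool" where
  "essentially_smooth D \<phi> \<longleftrightarrow>
     rel_interior D \<noteq> {} \<and>
     (\<forall>q\<in>rel_interior D. \<phi> differentiable (at q within D)) \<and>
     (\<forall>X x. (\<forall>n. X n \<in> rel_interior D) \<and> x \<in> rel_frontier D \<and> X \<longlonglongrightarrow> x \<longrightarrow>
        filterlim (\<lambda>n. norm (rel_gradient D \<phi> (X n))) at_top sequentially)"

definition legendre_type :: "'v::euclidean_space set \<Rightarrow> ('v \<Rightarrow> real) \<Rightarrow> bool" where
  "legendre_type D \<phi> \<longleftrightarrow>
     convex_on D \<phi> \<and> strictly_convex_on (rel_interior D) \<phi> \<and> essentially_smooth D \<phi>"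

text \<open>Meaningful for \<open>p \<in> D\<close> and \<open>q \<in> rel_interior D\<close>.\<close>

definition bregman :: "'v::euclidean_space set \<Rightarrow> ('v \<Rightarrow> real) \<Rightarrow> 'v \<Rightarrow> 'v \<Rightarrow> real" where
  "bregman D \<phi> p q = \<phi> p - \<phi> q - rel_gradient D \<phi> q \<bullet> (p - q)"

definition bregman_policy ::
  "(real ^ 'a) set \<Rightarrow> (real ^ 'a \<Rightarrow> real) \<Rightarrow> real ^ 'a::finite ^ 's \<Rightarrow> real ^ 'a ^ 's \<Rightarrow> real ^ 's::finite"
where
  "bregman_policy D \<phi> \<pi> \<pi>' = (\<chi> s. bregman D \<phi> (\<pi> $ s) (\<pi>' $ s))"

text \<open>
  Component-wise minimum of the divergence over a set of policies; written as an infimum, which is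
  the minimum whenever that exists.
\<close>

definition min_bregman ::
  "(real ^ 'a) set \<Rightarrow> (real ^ 'a \<Rightarrow> real) \<Rightarrow> (real ^ 'a::finite ^ 's) set \<Rightarrow> real ^ 'a ^ 's \<Rightarrow> real ^ 's::finite"
where
  "min_bregman D \<phi> G \<pi>' = (\<chi> s. INF \<pi>\<in>G. bregman_policy D \<phi> \<pi> \<pi>' $ s)"

section \<open>The exact h-PMD iteration\<close>

definition pmd_objective ::
  "('s::finite \<Rightarrow> 'a::finite \<Rightarrow> 's pmf) \<Rightarrow> ('s \<Rightarrow> 'a \<Rightarrow> real) \<Rightarrow> real \<Rightarrow>
   (real ^ 'a) set \<Rightarrow> (real ^ 'a \<Rightarrow> real) \<Rightarrow> nat \<Rightarrow> real \<Rightarrow> real ^ 'a ^ 's \<Rightarrow> real ^ 'a ^ 's \<Rightarrow> real ^ 's"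
where
  "pmd_objective P r \<gamma> D \<phi> h \<eta> \<pi>' \<pi> =
     \<eta> *\<^sub>R bellman_policy P r \<gamma> \<pi> ((bellman_opt P r \<gamma> ^^ (h - 1)) (value_fun P r \<gamma> \<pi>'))
       - bregman_policy D \<phi> \<pi> \<pi>'"

text \<open>
  The first conjunct says that all divergences from the iterates are defined. The maximisation is
  done in each state component separately; the maximiser is unique because \<open>\<phi>\<close> is strictly
  convex.
\<close>

definition generated_by_h_pmd ::
  "('s::finite \<Rightarrow> 'a::finite \<Rightarrow> 's pmf) \<Rightarrow> ('s \<Rightarrow> 'a \<Rightarrow> real) \<Rightarrow> real \<Rightarrow>
   (real ^ 'a) set \<Rightarrow> (real ^ 'a \<Rightarrow> real) \<Rightarrow> nat \<Rightarrow> (nat \<Rightarrow> real) \<Rightarrow> (nat \<Rightarrow> real ^ 'a ^ 's) \<Rightarrow> bool"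
where
  "generated_by_h_pmd P r \<gamma> D \<phi> h \<eta> \<pi> \<longleftrightarrow>
     (\<forall>k s. \<pi> k $ s \<in> rel_interior D) \<and>
     (\<forall>k s. is_arg_max (\<lambda>\<pi>'. pmd_objective P r \<gamma> D \<phi> h (\<eta> k) (\<pi> k) \<pi>' $ s)
              (\<lambda>\<pi>'. \<pi>' \<in> policies) (\<pi> (Suc k)))"

end

theory Submission
  imports Defs
begin

text \<open>
  Write \<open>V = V\<^sup>\<pi>\<close> for the current policy \<open>\<pi>\<close>, \<open>\<pi>'\<close> for the next one, and \<open>W = T\<^sup>h\<^sup>-\<^sup>1 V\<close>. Comparing \<open>\<pi>'\<close> with the greedy
  policies in the mirror descent objective, and using that Bregman divergences are nonnegative, the
  step size condition gives \<open>T\<^sup>\<pi>\<^sup>' W \<ge> T\<^sup>h V - c\<close>. Since \<open>T V \<ge> T\<^sup>\<pi> V = V\<close>, also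
  \<open>T\<^sup>h V \<ge> W\<close>, so \<open>W\<close> violates \<open>W \<le> T\<^sup>\<pi>\<^sup>' W\<close> by at most \<open>c\<close>, and contraction turns this into
  \<open>V\<^sup>\<pi>\<^sup>' \<ge> T\<^sup>h V - c / (1 - \<gamma>)\<close>. As \<open>V\<^sup>* \<le> T\<^sup>h V\<^sup>*\<close>, each iteration contracts the distance to
  \<open>V\<^sup>*\<close> by \<open>\<gamma>\<^sup>h\<close> up to \<open>c / (1 - \<gamma>)\<close>. The fixed point equation \<open>T\<^sup>\<pi> V\<^sup>\<pi> = V\<^sup>\<pi>\<close> only involves the
  one-time marginals of the trajectory, which are iterates of the state-action transition kernel.
\<close>

section \<open>Nonnegativity of Bregman divergences\<close>

text \<open>This is the tangent space appearing in \<open>rel_gradient_def\<close>. A difference of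
  two hull points is also a difference of their translates by \<open>-q\<close>, and the translated
  hull is a linear subspace.\<close>

lemma subspace_affine_hull_differences:
  fixes D :: "'v::euclidean_space set"
  assumes "q \<in> D"
  shows "subspace {x - y | x y. x \<in> affine hull D \<and> y \<in> affine hull D}"
    and "{x - y | x y. x \<in> affine hull D \<and> y \<in> affine hull D} = (\<lambda>x. x - q) ` (affine hull D)"
proof -
  have q: "q \<in> affine hull D" using assms by (rule hull_inc)
  have sub: "subspace ((\<lambda>x. x - q) ` (affine hull D))"
    using affine_diffs_subspace_subtract[OF affine_affine_hull q] .
  show eq: "{x - y | x y. x \<in> affine hull D \<and> y \<in> affine hull D} = (\<lambda>x. x - q) ` (affine hull D)"
  proof
    show "{x - y | x y. x \<in> affine hull D \<and> y \<in> affine hull D} \<subseteq> (\<lambda>x. x - q) ` (affine hull D)"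
    proof clarify
      fix x y assume "x \<in> affine hull D" "y \<in> affine hull D"
      then have "(x - q) - (y - q) \<in> (\<lambda>x. x - q) ` (affine hull D)"
        by (intro subspace_diff[OF sub] imageI)
      then show "x - y \<in> (\<lambda>x. x - q) ` (affine hull D)" by simp
    qed
    show "(\<lambda>x. x - q) ` (affine hull D) \<subseteq> {x - y | x y. x \<in> affine hull D \<and> y \<in> affine hull D}"
      using q by auto
  qed
  show "subspace {x - y | x y. x \<in> affine hull D \<and> y \<in> affine hull D}"
    using sub eq by simp
qed

text \<open>A derivative within \<open>D\<close> restricts to any segment of \<open>D\<close>
  issuing from \<open>q\<close>. The limit is one-sided because \<open>D\<close> is only assumed to
  contain the segment in the direction of \<open>v\<close>.\<close>

lemma directional_derivative_within:
  fixes \<phi> :: "'v::real_normed_vector \<Rightarrow> real"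
  assumes der: "(\<phi> has_derivative L) (at q within D)"
    and e: "e > 0" and seg: "\<And>t. 0 \<le> t \<Longrightarrow> t \<le> e \<Longrightarrow> q + t *\<^sub>R v \<in> D"
  shows "((\<lambda>t. (\<phi> (q + t *\<^sub>R v) - \<phi> q) / t) \<longlongrightarrow> L v) (at_right 0)"
proof -
  let ?f = "\<lambda>t::real. q + t *\<^sub>R v"
  have lin: "linear L" using der has_derivative_linear by blast
  have "?f ` {0..e} \<subseteq> D" using seg by auto
  then have "(\<phi> has_derivative L) (at (?f 0) within ?f ` {0..e})"
    using has_derivative_subset[OF der] by simp
  moreover have "(?f has_derivative (\<lambda>t. t *\<^sub>R v)) (at 0 within {0..e})"
    by (auto intro!: derivative_eq_intros)
  ultimately have "((\<lambda>t. \<phi> (?f t)) has_derivative (\<lambda>t. L (t *\<^sub>R v))) (at 0 within {0..e})"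
    by (rule has_derivative_in_compose[rotated])
  then have "((\<lambda>t. \<phi> (?f t)) has_real_derivative L v) (at 0 within {0..e})"
    by (simp add: has_field_derivative_def linear_scale[OF lin] mult.commute[of _ "L v"])
  then have "((\<lambda>t. (\<phi> (?f t) - \<phi> q) / t) \<longlongrightarrow> L v) (at 0 within {0..e})"
    by (simp add: has_field_derivative_iff)
  then show ?thesis
    using e by (simp add: at_within_Icc_at_right)
qed

text \<open>The definite description in \<open>rel_gradient\<close> is well-defined. Existence:
  project any representer of the derivative orthogonally onto the tangent space. Uniqueness: from a
  relative interior point one can move in every tangent direction, so directional derivatives
  determine the vector.\<close>

lemma rel_gradient_has_derivative:
  fixes D :: "'v::euclidean_space set"
  assumes q: "q \<in> rel_interior D" and diff: "\<phi> differentiable (at q within D)"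
  shows "(\<phi> has_derivative (\<lambda>v. rel_gradient D \<phi> q \<bullet> v)) (at q within D)"
proof -
  define S where "S = {x - y | x y. x \<in> affine hull D \<and> y \<in> affine hull D}"
  have qD: "q \<in> D" using q rel_interior_subset by blast
  have sub: "subspace S" and S_eq: "S = (\<lambda>x. x - q) ` (affine hull D)"
    unfolding S_def using subspace_affine_hull_differences[OF qD] by auto
  obtain \<epsilon> where eps: "\<epsilon> > 0" "cball q \<epsilon> \<inter> affine hull D \<subseteq> D"
    using q by (auto simp: mem_rel_interior_cball)
  \<comment> \<open>A small ball around \<open>q\<close>, cut by the affine hull, lies in
    \<open>D\<close>. The \<open>+ 1\<close> keeps the step length \<open>?e\<close> defined when
    \<open>v = 0\<close>.\<close>
  have seg: "\<exists>e>0. \<forall>t. 0 \<le> t \<and> t \<le> e \<longrightarrow> q + t *\<^sub>R v \<in> D" if v: "v \<in> S" for v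
  proof (intro exI conjI allI impI)
    let ?e = "\<epsilon> / (norm v + 1)"
    have n: "norm v + 1 > 0" using norm_ge_zero[of v] by linarith
    show "?e > 0" using eps(1) n by simp
    fix t assume t: "0 \<le> t \<and> t \<le> ?e"
    have "t * norm v \<le> t * (norm v + 1)" using t by (simp add: mult_left_mono)
    also have "\<dots> \<le> \<epsilon>" using t n by (simp add: pos_le_divide_eq)
    finally have "q + t *\<^sub>R v \<in> cball q \<epsilon>" using t by (simp add: dist_norm)
    moreover have "t *\<^sub>R v \<in> S" using sub v by (rule subspace_scale)
    then have "q + t *\<^sub>R v \<in> affine hull D" unfolding S_eq by (auto simp: algebra_simps)
    ultimately show "q + t *\<^sub>R v \<in> D" using eps(2) by blast
  qed
  obtain L where L: "(\<phi> has_derivative L) (at q within D)"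
    using diff by (auto simp: differentiable_def)
  have lin: "linear L" using L has_derivative_linear by blast
  \<comment> \<open>The witness is the adjoint of \<open>L\<close> evaluated at the real number
    1.\<close>
  obtain g0 where g0: "\<And>v. L v = g0 \<bullet> v"
    using linear_conv_bounded_linear lin
    by (metis adjoint_works inner_commute inner_real_def mult.right_neutral)
  \<comment> \<open>Only the component of the representer of \<open>L\<close> parallel to the affine hull is determined.\<close>
  obtain g z where g: "g \<in> span S" "\<And>w. w \<in> span S \<Longrightarrow> orthogonal z w" "g0 = g + z"
    using orthogonal_subspace_decomp_exists by metis
  have span: "span S = S" using sub by simp
  have gv: "g \<bullet> v = L v" if "v \<in> S" for v
    using g that by (auto simp: span g0 orthogonal_def inner_add_left)
  have gS: "g \<in> S" using g span by simp
  have "(\<phi> has_derivative (\<lambda>v. g \<bullet> v)) (at q within D)"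
    using L unfolding has_derivative_within
  proof (elim conjE, intro conjI)
    show "bounded_linear (\<lambda>v. g \<bullet> v)" by (rule bounded_linear_inner_right)
    assume lim: "((\<lambda>y. (1 / norm (y - q)) *\<^sub>R (\<phi> y - (\<phi> q + L (y - q)))) \<longlongrightarrow> 0) (at q within D)"
    \<comment> \<open>The limit only sees \<open>y\<close> in \<open>D\<close>. Then
      \<open>y - q\<close> is tangent, where \<open>g\<close> and \<open>L\<close> agree.\<close>
    show "((\<lambda>y. (1 / norm (y - q)) *\<^sub>R (\<phi> y - (\<phi> q + g \<bullet> (y - q)))) \<longlongrightarrow> 0) (at q within D)"
    proof (rule Lim_transform_eventually[OF lim])
      show "\<forall>\<^sub>F y in at q within D. (1 / norm (y - q)) *\<^sub>R (\<phi> y - (\<phi> q + L (y - q))) =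
          (1 / norm (y - q)) *\<^sub>R (\<phi> y - (\<phi> q + g \<bullet> (y - q)))"
        unfolding eventually_at_filter
        by (rule always_eventually) (auto simp: gv S_eq hull_inc)
    qed
  qed
  moreover have "g' = g" if g': "g' \<in> S" "(\<phi> has_derivative (\<lambda>v. g' \<bullet> v)) (at q within D)"
    for g'
  proof -
    \<comment> \<open>The direction tested is \<open>g' - g\<close> itself: both derivatives give
      the same one-sided limit along it, so \<open>g' - g\<close> is orthogonal to itself.\<close>
    have d: "g' - g \<in> S" using sub g' gS by (intro subspace_diff)
    obtain e where e: "e > 0" "\<And>t. 0 \<le> t \<Longrightarrow> t \<le> e \<Longrightarrow> q + t *\<^sub>R (g' - g) \<in> D"
      using seg[OF d] by blast
    have "g' \<bullet> (g' - g) = L (g' - g)"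
      by (rule tendsto_unique[OF _ directional_derivative_within[OF g'(2) e]
            directional_derivative_within[OF L e]]) auto
    then have "(g' - g) \<bullet> (g' - g) = 0" using gv[OF d] by (simp add: inner_diff_left)
    then show ?thesis by simp
  qed
  ultimately have "\<exists>!g. g \<in> S \<and> (\<phi> has_derivative (\<lambda>v. g \<bullet> v)) (at q within D)"
    using gS by blast
  from theI'[OF this] show ?thesis
    unfolding rel_gradient_def S_def by blast
qed

text \<open>Convexity bounds the difference quotients along the segment from \<open>q\<close> to
  \<open>p\<close> by \<open>\<phi> p - \<phi> q\<close>; their limit at \<open>q\<close> is the
  gradient term.\<close>

lemma bregman_nonneg:
  assumes leg: "legendre_type D \<phi>" and p: "p \<in> D" and q: "q \<in> rel_interior D"
  shows "bregman D \<phi> p q \<ge> 0"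
proof -
  have conv: "convex_on D \<phi>" and diff: "\<phi> differentiable (at q within D)"
    using leg q by (auto simp: legendre_type_def essentially_smooth_def)
  have qD: "q \<in> D" using q rel_interior_subset by blast
  have eq: "q + t *\<^sub>R (p - q) = (1 - t) *\<^sub>R q + t *\<^sub>R p" for t
    by (simp add: algebra_simps)
  have seg: "q + t *\<^sub>R (p - q) \<in> D" if "0 \<le> t" "t \<le> 1" for t
    unfolding eq using convex_on_imp_convex[OF conv] qD p that by (intro convexD) auto
  have "((\<lambda>t. (\<phi> (q + t *\<^sub>R (p - q)) - \<phi> q) / t) \<longlongrightarrow> rel_gradient D \<phi> q \<bullet> (p - q)) (at_right 0)"
    by (rule directional_derivative_within[OF rel_gradient_has_derivative[OF q diff], of 1])
      (use seg in auto)
  moreover have "\<forall>\<^sub>F t in at_right 0. (\<phi> (q + t *\<^sub>R (p - q)) - \<phi> q) / t \<le> \<phi> p - \<phi> q"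
    unfolding eventually_at_right_field
  proof (intro exI[of _ 1] conjI allI impI)
    fix t :: real assume t: "0 < t" "t < 1"
    have "\<phi> (q + t *\<^sub>R (p - q)) \<le> (1 - t) * \<phi> q + t * \<phi> p"
      unfolding eq using convex_onD[OF conv, of t q p] t qD p by simp
    then have "\<phi> (q + t *\<^sub>R (p - q)) - \<phi> q \<le> (\<phi> p - \<phi> q) * t"
      by (simp add: algebra_simps)
    then show "(\<phi> (q + t *\<^sub>R (p - q)) - \<phi> q) / t \<le> \<phi> p - \<phi> q"
      using t by (simp add: pos_divide_le_eq)
  qed simp
  ultimately have "rel_gradient D \<phi> q \<bullet> (p - q) \<le> \<phi> p - \<phi> q"
    by (rule tendsto_upperbound) simp
  then show ?thesis by (simp add: bregman_def)
qed

section \<open>The Bellman equation of the trajectory model\<close>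

text \<open>The \<open>Suc\<close> case of \<open>step_kernel\<close>, which sees the history only
  through the last pair.\<close>

definition next_pmf ::
  "('s::finite \<Rightarrow> 'a::finite \<Rightarrow> 's pmf) \<Rightarrow> real ^ 'a ^ 's \<Rightarrow> 's \<times> 'a \<Rightarrow> ('s \<times> 'a) pmf"
where
  "next_pmf P \<pi> x = bind_pmf (P (fst x) (snd x)) (state_action_pmf \<pi>)"

text \<open>The initial law is an argument, so that mixtures of initial laws can be pulled out of
  the iteration.\<close>

definition marginal ::
  "('s::finite \<Rightarrow> 'a::finite \<Rightarrow> 's pmf) \<Rightarrow> real ^ 'a ^ 's \<Rightarrow> nat \<Rightarrow> ('s \<times> 'a) pmf \<Rightarrow> ('s \<times> 'a) pmf"
where
  "marginal P \<pi> t = (\<lambda>\<mu>. bind_pmf \<mu> (next_pmf P \<pi>)) ^^ t"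

lemma marginal_0 [simp]: "marginal P \<pi> 0 \<mu> = \<mu>"
  by (simp add: marginal_def)

lemma marginal_Suc: "marginal P \<pi> (Suc t) \<mu> = bind_pmf (marginal P \<pi> t \<mu>) (next_pmf P \<pi>)"
  by (simp add: marginal_def)

lemma marginal_bind: "marginal P \<pi> t (bind_pmf \<mu> f) = bind_pmf \<mu> (\<lambda>x. marginal P \<pi> t (f x))"
  by (induction t) (simp_all add: marginal_Suc bind_assoc_pmf)

text \<open>First-step decomposition: unlike \<open>marginal_Suc\<close>, it splits off the first
  transition instead of the last, as the Bellman equation requires.\<close>

lemma marginal_Suc_state_action:
  "marginal P \<pi> (Suc t) (state_action_pmf \<pi> s) =
     bind_pmf (policy_pmf \<pi> s) (\<lambda>a. bind_pmf (P s a) (\<lambda>s'. marginal P \<pi> t (state_action_pmf \<pi> s')))"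
proof -
  have "marginal P \<pi> (Suc t) (state_action_pmf \<pi> s)
      = marginal P \<pi> t (bind_pmf (state_action_pmf \<pi> s) (next_pmf P \<pi>))"
    unfolding marginal_def funpow_Suc_right by simp
  also have "\<dots> = bind_pmf (policy_pmf \<pi> s)
      (\<lambda>a. bind_pmf (P s a) (\<lambda>s'. marginal P \<pi> t (state_action_pmf \<pi> s')))"
    by (simp add: state_action_pmf_def[of \<pi> s] bind_map_pmf next_pmf_def marginal_bind)
  finally show ?thesis .
qed

section \<open>One-time marginals of the trajectory law\<close>

context
  fixes P :: "'s::finite \<Rightarrow> 'a::finite \<Rightarrow> 's pmf" and \<pi> :: "real ^ 'a ^ 's" and s :: 's
begin

interpretation IT: Ionescu_Tulcea "step_kernel P \<pi> s" "\<lambda>_. count_space UNIV"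
  by (rule Ionescu_Tulcea_step_kernel)

text \<open>\<open>IT.C 0 (Suc t)\<close> is the law of the pairs at times \<open>0..t\<close>.
  Integrating out the last one replaces \<open>f\<close> by its one-step expectation, a function of
  the previous pair; hence the induction is over all \<open>f\<close>.\<close>

lemma nn_integral_C_step_kernel:
  fixes f :: "'s \<times> 'a \<Rightarrow> ennreal"
  shows "(\<integral>\<^sup>+\<omega>. f (\<omega> t) \<partial>IT.C 0 (Suc t) (\<lambda>_. undefined)) =
           (\<integral>\<^sup>+x. f x \<partial>marginal P \<pi> t (state_action_pmf \<pi> s))"
proof (induction t arbitrary: f)
  have space: "\<omega> \<in> space (PiM {0..<t} (\<lambda>_. count_space UNIV))"
    if "\<omega> \<in> space (IT.C 0 t (\<lambda>_. undefined))" for \<omega> t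
    using that by (subst (asm) IT.space_C) (auto simp: space_PiM)
  have step: "(\<integral>\<^sup>+\<omega>. f (\<omega> t) \<partial>IT.C 0 (Suc t) (\<lambda>_. undefined)) =
      (\<integral>\<^sup>+\<omega>. \<integral>\<^sup>+x. f x \<partial>step_kernel P \<pi> s t \<omega> \<partial>IT.C 0 t (\<lambda>_. undefined))"
    for t and f :: "'s \<times> 'a \<Rightarrow> ennreal"
  proof -
    have f: "(\<lambda>\<omega>. f (\<omega> t)) \<in> borel_measurable (PiM {0..<Suc t} (\<lambda>_. count_space UNIV))"
      by (rule measurable_compose[OF measurable_component_singleton]) auto
    have "(\<integral>\<^sup>+\<omega>. f (\<omega> t) \<partial>IT.C 0 (Suc t) (\<lambda>_. undefined)) =
        (\<integral>\<^sup>+\<omega>. \<integral>\<^sup>+\<omega>'. f (\<omega>' t) \<partial>IT.eP t \<omega> \<partial>IT.C 0 t (\<lambda>_. undefined))"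
    proof -
      have "IT.eP t \<in> measurable (IT.C 0 t (\<lambda>_. undefined))
          (subprob_algebra (PiM {0..<Suc t} (\<lambda>_. count_space UNIV)))"
        using IT.measurable_eP[of t]
        by (subst measurable_cong_sets[OF IT.sets_C refl]) auto
      from nn_integral_bind[OF f this] show ?thesis by simp
    qed
    also have "\<dots> = (\<integral>\<^sup>+\<omega>. \<integral>\<^sup>+x. f x \<partial>step_kernel P \<pi> s t \<omega> \<partial>IT.C 0 t (\<lambda>_. undefined))"
      by (rule nn_integral_cong) (subst IT.nn_integral_eP[OF space f], auto)
    finally show ?thesis .
  qed
  {
    case 0
    \<comment> \<open>The kernel at time 0 ignores the history, so the outer integrand is constant
      and only total mass one matters.\<close>
    interpret prob_space "IT.C 0 0 (\<lambda>_. undefined)"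
      by (rule IT.prob_space_C) simp
    show ?case
      unfolding step by (simp add: step_kernel_def emeasure_space_1 del: IT.C.simps)
  next
    case (Suc t)
    let ?g = "\<lambda>x. \<integral>\<^sup>+y. f y \<partial>next_pmf P \<pi> x"
    have "(\<integral>\<^sup>+\<omega>. f (\<omega> (Suc t)) \<partial>IT.C 0 (Suc (Suc t)) (\<lambda>_. undefined)) =
        (\<integral>\<^sup>+\<omega>. ?g (\<omega> t) \<partial>IT.C 0 (Suc t) (\<lambda>_. undefined))"
      unfolding step by (simp add: step_kernel_def next_pmf_def)
    also have "\<dots> = (\<integral>\<^sup>+x. ?g x \<partial>marginal P \<pi> t (state_action_pmf \<pi> s))"
      by (rule Suc)
    finally show ?case by (simp add: marginal_Suc)
  }
qed

lemma sets_trajectory: "sets (trajectory P \<pi> s) = sets (PiM UNIV (\<lambda>_. count_space UNIV))"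
  unfolding trajectory_def by (rule IT.PF.sets_lim)

lemma measurable_trajectory_component [measurable]:
  "(\<lambda>\<omega>. \<omega> t) \<in> measurable (trajectory P \<pi> s) (count_space UNIV)"
  by (subst measurable_cong_sets[OF sets_trajectory refl]) (rule measurable_component_singleton, simp)

text \<open>A projective limit is accessible through its finite-dimensional restrictions, so the
  coordinate \<open>t\<close> is factored through the restriction to times
  \<open>0..t\<close>.\<close>

lemma distr_trajectory_component:
  "distr (trajectory P \<pi> s) (count_space UNIV) (\<lambda>\<omega>. \<omega> t) =
     measure_pmf (marginal P \<pi> t (state_action_pmf \<pi> s))"
proof (rule measure_eqI)
  let ?M = "\<lambda>_::nat. count_space (UNIV :: ('s \<times> 'a) set)"
  let ?J = "{0..<Suc t}"
  fix A :: "('s \<times> 'a) set"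
  have up: "IT.up_to ?J = Suc t"
    by (rule antisym) (auto simp: IT.up_to_iff Suc_le_eq intro: IT.up_to_less)
  have m: "(\<lambda>\<omega>. \<omega> t) \<in> measurable (PiM ?J ?M) (count_space UNIV)"
    by (rule measurable_component_singleton) simp
  have r: "(\<lambda>\<omega>. restrict \<omega> ?J) \<in> measurable (trajectory P \<pi> s) (PiM ?J ?M)"
    by (subst measurable_cong_sets[OF sets_trajectory refl]) (rule measurable_restrict_subset, simp)
  \<comment> \<open>On an initial segment of times the restriction built into \<open>IT.CI\<close>
    changes nothing.\<close>
  have CI: "IT.CI ?J = IT.C 0 (Suc t) (\<lambda>_. undefined)"
    unfolding IT.CI_def up using IT.distr_C[of "Suc t" "Suc t" "\<lambda>_. undefined" 0] by simp
  have "distr (trajectory P \<pi> s) (count_space UNIV) (\<lambda>\<omega>. \<omega> t) =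
      distr (distr (trajectory P \<pi> s) (PiM ?J ?M) (\<lambda>\<omega>. restrict \<omega> ?J)) (count_space UNIV) (\<lambda>\<omega>. \<omega> t)"
    by (subst distr_distr[OF m r]) (simp add: comp_def)
  also have "\<dots> = distr (IT.C 0 (Suc t) (\<lambda>_. undefined)) (count_space UNIV) (\<lambda>\<omega>. \<omega> t)"
    unfolding trajectory_def by (subst IT.distr_lim) (simp_all add: CI del: IT.C.simps)
  finally have eq: "distr (trajectory P \<pi> s) (count_space UNIV) (\<lambda>\<omega>. \<omega> t) = \<dots>" .
  have m': "(\<lambda>\<omega>. \<omega> t) \<in> measurable (IT.C 0 (Suc t) (\<lambda>_. undefined)) (count_space UNIV)"
    using m by (subst measurable_cong_sets[OF IT.sets_C refl]) auto
  have "emeasure (distr (IT.C 0 (Suc t) (\<lambda>_. undefined)) (count_space UNIV) (\<lambda>\<omega>. \<omega> t)) A =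
      (\<integral>\<^sup>+\<omega>. indicator A (\<omega> t) \<partial>IT.C 0 (Suc t) (\<lambda>_. undefined))"
    by (subst nn_integral_distr[OF m', symmetric]) auto
  also have "\<dots> = emeasure (measure_pmf (marginal P \<pi> t (state_action_pmf \<pi> s))) A"
    by (subst nn_integral_C_step_kernel) simp
  finally show "emeasure (distr (trajectory P \<pi> s) (count_space UNIV) (\<lambda>\<omega>. \<omega> t)) A =
      emeasure (measure_pmf (marginal P \<pi> t (state_action_pmf \<pi> s))) A"
    using eq by simp
qed simp

end

section \<open>The value function as a discounted series\<close>

definition expected_reward ::
  "('s::finite \<Rightarrow> 'a::finite \<Rightarrow> 's pmf) \<Rightarrow> ('s \<Rightarrow> 'a \<Rightarrow> real) \<Rightarrow> real ^ 'a ^ 's \<Rightarrow> nat \<Rightarrow> 's \<Rightarrow> real"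
where
  "expected_reward P r \<pi> t s =
     measure_pmf.expectation (marginal P \<pi> t (state_action_pmf \<pi> s)) (\<lambda>x. r (fst x) (snd x))"

lemma pmf_policy_pmf:
  assumes "\<pi> \<in> policies"
  shows "pmf (policy_pmf \<pi> s) a = \<pi> $ s $ a"
proof -
  have nn: "\<And>a. 0 \<le> \<pi> $ s $ a" and one: "(\<Sum>a\<in>UNIV. \<pi> $ s $ a) = 1"
    using assms by (auto simp: policies_def prob_simplex_def)
  have "(\<integral>\<^sup>+a. ennreal (\<pi> $ s $ a) \<partial>count_space UNIV) = 1"
    by (simp add: nn_integral_count_space_finite nn one)
  then show ?thesis
    unfolding policy_pmf_def by (intro pmf_embed_pmf nn)
qed

lemma expected_reward_0:
  assumes "\<pi> \<in> policies"
  shows "expected_reward P r \<pi> 0 s = (\<Sum>a\<in>UNIV. \<pi> $ s $ a * r s a)"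
  unfolding expected_reward_def
  by (simp add: state_action_pmf_def integral_measure_pmf[of UNIV] pmf_policy_pmf[OF assms])

lemma expected_reward_Suc:
  assumes "\<pi> \<in> policies"
  shows "expected_reward P r \<pi> (Suc t) s =
    (\<Sum>a\<in>UNIV. \<pi> $ s $ a * (\<Sum>s'\<in>UNIV. pmf (P s a) s' * expected_reward P r \<pi> t s'))"
  unfolding expected_reward_def marginal_Suc_state_action
  by (simp add: pmf_expectation_bind[of UNIV] pmf_policy_pmf[OF assms])

lemma expected_reward_bounds:
  assumes "\<And>s a. r s a \<in> {0..1}"
  shows "0 \<le> expected_reward P r \<pi> t s" "expected_reward P r \<pi> t s \<le> 1"
proof -
  show "0 \<le> expected_reward P r \<pi> t s"
    unfolding expected_reward_def using assms by (intro Bochner_Integration.integral_nonneg) auto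
  show "expected_reward P r \<pi> t s \<le> 1"
    unfolding expected_reward_def
    by (intro measure_pmf.integral_le_const integrable_measure_pmf_finite AE_I2)
      (use assms in auto)
qed

lemma summable_discounted:
  fixes f :: "nat \<Rightarrow> real"
  assumes "0 < \<gamma>" "\<gamma> < 1" "\<And>t. 0 \<le> f t" "\<And>t. f t \<le> 1"
  shows "summable (\<lambda>t. \<gamma> ^ t * f t)"
proof (rule summable_comparison_test'[of "\<lambda>t. \<gamma> ^ t" 0])
  show "summable (\<lambda>t. \<gamma> ^ t)" using assms by (intro summable_geometric) auto
  show "norm (\<gamma> ^ t * f t) \<le> \<gamma> ^ t" for t
    using assms by (simp add: abs_mult mult_left_le)
qed

text \<open>Integral and series may be exchanged because rewards in \<open>[0, 1]\<close> give
  domination by the geometric series. Each term then involves a single time, hence only a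
  marginal.\<close>

lemma value_fun_eq_suminf:
  assumes reward: "\<And>s a. r s a \<in> {0..1}" and \<gamma>: "0 < \<gamma>" "\<gamma> < 1"
  shows "value_fun P r \<gamma> \<pi> $ s = (\<Sum>t. \<gamma> ^ t * expected_reward P r \<pi> t s)"
proof -
  let ?T = "trajectory P \<pi> s"
  let ?r = "\<lambda>t (\<omega> :: nat \<Rightarrow> 'a \<times> 'b). r (fst (\<omega> t)) (snd (\<omega> t))"
  have dist: "distr ?T (count_space UNIV) (\<lambda>\<omega>. \<omega> t) =
      measure_pmf (marginal P \<pi> t (state_action_pmf \<pi> s))" for t
    by (rule distr_trajectory_component)
  have int: "integrable ?T (\<lambda>\<omega>. ?r t \<omega>)" for t
  proof -
    have "integrable (distr ?T (count_space UNIV) (\<lambda>\<omega>. \<omega> t)) (\<lambda>x. r (fst x) (snd x))"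
      unfolding dist by (rule integrable_measure_pmf_finite) simp
    then show ?thesis by (subst (asm) integrable_distr_eq) auto
  qed
  have exp: "(\<integral>\<omega>. ?r t \<omega> \<partial>?T) = expected_reward P r \<pi> t s" for t
    unfolding expected_reward_def dist[symmetric]
    by (subst integral_distr) auto
  have norm: "norm (\<gamma> ^ t * ?r t \<omega>) = \<gamma> ^ t * ?r t \<omega>" for t \<omega>
    using reward \<gamma> by (simp add: abs_mult)
  have "(\<integral>\<omega>. (\<Sum>t. \<gamma> ^ t * ?r t \<omega>) \<partial>?T) = (\<Sum>t. \<integral>\<omega>. \<gamma> ^ t * ?r t \<omega> \<partial>?T)"
  proof (rule integral_suminf)
    show "integrable ?T (\<lambda>\<omega>. \<gamma> ^ t * ?r t \<omega>)" for t
      using int by simp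
    show "AE \<omega> in ?T. summable (\<lambda>t. norm (\<gamma> ^ t * ?r t \<omega>))"
      unfolding norm using reward by (intro AE_I2 summable_discounted \<gamma>) auto
    show "summable (\<lambda>t. \<integral>\<omega>. norm (\<gamma> ^ t * ?r t \<omega>) \<partial>?T)"
      unfolding norm using expected_reward_bounds[of r P \<pi>, OF reward]
      by (simp add: exp) (intro summable_discounted \<gamma>)
  qed
  then show ?thesis by (simp add: value_fun_def exp)
qed

text \<open>The bound is uniform in \<open>\<pi>\<close>, which makes the real supremum in
  \<open>opt_value\<close> a genuine upper bound.\<close>

lemma value_fun_le:
  assumes reward: "\<And>s a. r s a \<in> {0..1}" and \<gamma>: "0 < \<gamma>" "\<gamma> < 1"
  shows "value_fun P r \<gamma> \<pi> $ s \<le> 1 / (1 - \<gamma>)"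
proof -
  note b = expected_reward_bounds[of r P \<pi>, OF reward]
  have "(\<Sum>t. \<gamma> ^ t * expected_reward P r \<pi> t s) \<le> (\<Sum>t. \<gamma> ^ t)"
    using b \<gamma> by (intro suminf_le summable_discounted summable_geometric) (auto simp: mult_left_le)
  then show ?thesis
    using \<gamma> by (simp add: value_fun_eq_suminf[OF reward \<gamma>] suminf_geometric)
qed

text \<open>Averaging the series over the first transition and multiplying by
  \<open>\<gamma>\<close> gives the series at \<open>s\<close> without its first term, by
  \<open>expected_reward_Suc\<close>.\<close>

lemma bellman_policy_value_fun:
  assumes \<pi>: "\<pi> \<in> policies" and reward: "\<And>s a. r s a \<in> {0..1}" and \<gamma>: "0 < \<gamma>" "\<gamma> < 1"
  shows "bellman_policy P r \<gamma> \<pi> (value_fun P r \<gamma> \<pi>) = value_fun P r \<gamma> \<pi>"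
proof (rule vec_eq_iff[THEN iffD2], rule allI)
  fix s
  note V = value_fun_eq_suminf[OF reward \<gamma>]
  let ?e = "expected_reward P r \<pi>"
  have sums: "(\<lambda>t. \<gamma> ^ t * ?e t s) sums (value_fun P r \<gamma> \<pi> $ s)" for s
    unfolding V using expected_reward_bounds[of r P \<pi>, OF reward]
    by (intro summable_sums summable_discounted \<gamma>)
  have "(\<lambda>t. \<gamma> * (\<Sum>a\<in>UNIV. \<pi> $ s $ a * (\<Sum>s'\<in>UNIV. pmf (P s a) s' * (\<gamma> ^ t * ?e t s')))) sums
      (\<gamma> * (\<Sum>a\<in>UNIV. \<pi> $ s $ a * (\<Sum>s'\<in>UNIV. pmf (P s a) s' * value_fun P r \<gamma> \<pi> $ s')))"
    by (intro sums_mult sums_sum sums)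
  also have "(\<lambda>t. \<gamma> * (\<Sum>a\<in>UNIV. \<pi> $ s $ a * (\<Sum>s'\<in>UNIV. pmf (P s a) s' * (\<gamma> ^ t * ?e t s'))))
      = (\<lambda>t. \<gamma> ^ Suc t * ?e (Suc t) s)"
    by (simp add: expected_reward_Suc[OF \<pi>] sum_distrib_left mult_ac)
  \<comment> \<open>Undoing the index shift adds the term of time 0, the expected immediate
    reward.\<close>
  finally have "(\<lambda>t. \<gamma> ^ t * ?e t s) sums (\<gamma> * (\<Sum>a\<in>UNIV. \<pi> $ s $ a *
      (\<Sum>s'\<in>UNIV. pmf (P s a) s' * value_fun P r \<gamma> \<pi> $ s')) + (\<Sum>a\<in>UNIV. \<pi> $ s $ a * r s a))"
    by (subst (asm) sums_Suc_iff) (simp add: expected_reward_0[OF \<pi>])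
  from sums_unique2[OF sums this]
  show "bellman_policy P r \<gamma> \<pi> (value_fun P r \<gamma> \<pi>) $ s = value_fun P r \<gamma> \<pi> $ s"
    by (simp add: bellman_policy_def q_backup_def distrib_left sum.distrib sum_distrib_left mult_ac)
qed

section \<open>Bellman operators and the convergence rate\<close>

lemma infnorm_cart_le_iff: "infnorm (x :: real ^ 'n) \<le> b \<longleftrightarrow> (\<forall>i. \<bar>x $ i\<bar> \<le> b)"
proof
  assume "infnorm x \<le> b"
  then show "\<forall>i. \<bar>x $ i\<bar> \<le> b"
    using component_le_infnorm_cart[of x] order_trans by blast
next
  assume "\<forall>i. \<bar>x $ i\<bar> \<le> b"
  then show "infnorm x \<le> b"
    unfolding infnorm_cart by (intro cSup_least) auto
qed

text \<open>Transition probabilities sum to one, so a constant \<open>d\<close> passes through with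
  factor \<open>\<gamma>\<close>. This one-sided form covers monotonicity (\<open>d = 0\<close>) and
  contraction at once.\<close>

lemma q_backup_shift:
  fixes P :: "'s::finite \<Rightarrow> 'a::finite \<Rightarrow> 's pmf"
  assumes \<gamma>: "0 \<le> \<gamma>" and le: "\<And>s. V $ s \<le> W $ s + d"
  shows "q_backup P r \<gamma> V s a \<le> q_backup P r \<gamma> W s a + \<gamma> * d"
proof -
  have one: "(\<Sum>s'\<in>UNIV. pmf (P s a) s') = 1" by (rule sum_pmf_eq_1) auto
  have "(\<Sum>s'\<in>UNIV. pmf (P s a) s' * V $ s') \<le> (\<Sum>s'\<in>UNIV. pmf (P s a) s' * (W $ s' + d))"
    by (intro sum_mono mult_left_mono le) simp
  also have "\<dots> = (\<Sum>s'\<in>UNIV. pmf (P s a) s' * W $ s') + d"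
    by (simp add: distrib_left sum.distrib sum_distrib_right[symmetric] one)
  finally show ?thesis
    using mult_left_mono[OF _ \<gamma>] by (fastforce simp: q_backup_def distrib_left[symmetric])
qed

lemma bellman_policy_shift:
  fixes P :: "'s::finite \<Rightarrow> 'a::finite \<Rightarrow> 's pmf"
  assumes \<pi>: "\<pi> \<in> policies" and \<gamma>: "0 \<le> \<gamma>" and le: "\<And>s. V $ s \<le> W $ s + d"
  shows "bellman_policy P r \<gamma> \<pi> V $ s \<le> bellman_policy P r \<gamma> \<pi> W $ s + \<gamma> * d"
proof -
  have nn: "\<And>a. 0 \<le> \<pi> $ s $ a" and one: "(\<Sum>a\<in>UNIV. \<pi> $ s $ a) = 1"
    using \<pi> by (auto simp: policies_def prob_simplex_def)
  have "bellman_policy P r \<gamma> \<pi> V $ s \<le> (\<Sum>a\<in>UNIV. \<pi> $ s $ a * (q_backup P r \<gamma> W s a + \<gamma> * d))"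
    unfolding bellman_policy_def vec_lambda_beta
    by (intro sum_mono mult_left_mono nn q_backup_shift \<gamma> le)
  also have "\<dots> = bellman_policy P r \<gamma> \<pi> W $ s + \<gamma> * d"
    by (simp add: bellman_policy_def distrib_left sum.distrib sum_distrib_right[symmetric] one)
  finally show ?thesis .
qed

lemma q_backup_le_bellman_opt: "q_backup P r \<gamma> V s a \<le> bellman_opt P r \<gamma> V $ s"
  by (simp add: bellman_opt_def)

lemma bellman_opt_shift:
  fixes P :: "'s::finite \<Rightarrow> 'a::finite \<Rightarrow> 's pmf"
  assumes "0 \<le> \<gamma>" "\<And>s. V $ s \<le> W $ s + d"
  shows "bellman_opt P r \<gamma> V $ s \<le> bellman_opt P r \<gamma> W $ s + \<gamma> * d"
proof -
  have "q_backup P r \<gamma> V s a \<le> bellman_opt P r \<gamma> W $ s + \<gamma> * d" for a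
    using q_backup_shift[OF assms, of P r s a] q_backup_le_bellman_opt[of P r \<gamma> W s a] by linarith
  then show ?thesis by (simp add: bellman_opt_def[of P r \<gamma> V])
qed

lemma funpow_bellman_opt_shift:
  fixes P :: "'s::finite \<Rightarrow> 'a::finite \<Rightarrow> 's pmf"
  assumes \<gamma>: "0 \<le> \<gamma>" and le: "\<And>s. V $ s \<le> W $ s + d"
  shows "(bellman_opt P r \<gamma> ^^ n) V $ s \<le> (bellman_opt P r \<gamma> ^^ n) W $ s + \<gamma> ^ n * d"
proof (induction n arbitrary: s)
  case 0
  then show ?case using le by simp
next
  case (Suc n)
  from bellman_opt_shift[OF \<gamma> this] show ?case by (simp add: mult.assoc)
qed

section \<open>Policy operators compared with the optimality operator and the value function\<close>

lemma bellman_policy_le_bellman_opt: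
  assumes "\<pi> \<in> policies"
  shows "bellman_policy P r \<gamma> \<pi> V $ s \<le> bellman_opt P r \<gamma> V $ s"
proof -
  have nn: "\<And>a. 0 \<le> \<pi> $ s $ a" and one: "(\<Sum>a\<in>UNIV. \<pi> $ s $ a) = 1"
    using assms by (auto simp: policies_def prob_simplex_def)
  have "bellman_policy P r \<gamma> \<pi> V $ s \<le> (\<Sum>a\<in>UNIV. \<pi> $ s $ a * bellman_opt P r \<gamma> V $ s)"
    unfolding bellman_policy_def vec_lambda_beta
    by (intro sum_mono mult_left_mono nn q_backup_le_bellman_opt)
  then show ?thesis by (simp add: sum_distrib_right[symmetric] one)
qed

text \<open>A deterministic policy choosing a maximising action in each state; a point mass is an
  \<open>axis\<close> vector.\<close>

lemma ex_bellman_opt_greedy: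
  fixes P :: "'s::finite \<Rightarrow> 'a::finite \<Rightarrow> 's pmf"
  shows "\<exists>\<pi>\<in>policies. bellman_policy P r \<gamma> \<pi> V = bellman_opt P r \<gamma> V"
proof -
  have "\<exists>a. q_backup P r \<gamma> V s a = bellman_opt P r \<gamma> V $ s" for s
  proof -
    have "bellman_opt P r \<gamma> V $ s \<in> range (q_backup P r \<gamma> V s)"
      unfolding bellman_opt_def vec_lambda_beta by (rule Max_in) auto
    then show ?thesis by (elim rangeE) (intro exI, erule sym)
  qed
  then obtain f where f: "\<And>s. q_backup P r \<gamma> V s (f s) = bellman_opt P r \<gamma> V $ s"
    by metis
  let ?\<pi> = "\<chi> s. axis (f s) (1::real)"
  have "?\<pi> \<in> policies"
    by (auto simp: policies_def prob_simplex_def axis_def)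
  moreover have "bellman_policy P r \<gamma> ?\<pi> V = bellman_opt P r \<gamma> V"
    by (simp add: vec_eq_iff bellman_policy_def axis_def f if_distrib[of "\<lambda>x. x * _"] cong: if_cong)
  ultimately show ?thesis by blast
qed

text \<open>Ensures that the infimum in \<open>min_bregman\<close> ranges over a nonempty
  set.\<close>

lemma greedy_policies_nonempty:
  assumes "h \<ge> 1"
  shows "greedy_policies P r \<gamma> h V \<noteq> {}"
proof -
  have "(bellman_opt P r \<gamma> ^^ h) V = bellman_opt P r \<gamma> ((bellman_opt P r \<gamma> ^^ (h - 1)) V)"
    using assms by (cases h) auto
  then show ?thesis
    using ex_bellman_opt_greedy[of P r \<gamma> "(bellman_opt P r \<gamma> ^^ (h - 1)) V"]
    by (auto simp: greedy_policies_def)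
qed

text \<open>Let \<open>m\<close> be the largest excess of \<open>W\<close> over the value function,
  attained as there are finitely many states. One application of the operator gives
  \<open>m \<le> \<gamma> * m + d\<close>, so \<open>m \<le> d / (1 - \<gamma>)\<close>. Bounding
  the image of \<open>W\<close> rather than \<open>W\<close> gains a factor
  \<open>\<gamma>\<close>.\<close>

lemma bellman_policy_le_value_fun:
  fixes P :: "'s::finite \<Rightarrow> 'a::finite \<Rightarrow> 's pmf"
  assumes \<pi>: "\<pi> \<in> policies" and reward: "\<And>s a. r s a \<in> {0..1}" and \<gamma>: "0 < \<gamma>" "\<gamma> < 1"
    and W: "\<And>s. W $ s \<le> bellman_policy P r \<gamma> \<pi> W $ s + d"
  shows "bellman_policy P r \<gamma> \<pi> W $ s \<le> value_fun P r \<gamma> \<pi> $ s + \<gamma> * d / (1 - \<gamma>)"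
proof -
  let ?V = "value_fun P r \<gamma> \<pi>"
  note \<gamma>0 = less_imp_le[OF \<gamma>(1)]
  define m where "m = (MAX s. W $ s - ?V $ s)"
  have "W $ s - ?V $ s \<le> m" for s unfolding m_def by simp
  then have m: "W $ s \<le> ?V $ s + m" for s by (simp add: algebra_simps)
  have T: "bellman_policy P r \<gamma> \<pi> W $ s \<le> ?V $ s + \<gamma> * m" for s
    using bellman_policy_shift[where P = P and r = r and s = s, OF \<pi> \<gamma>0 m]
    by (simp add: bellman_policy_value_fun[OF \<pi> reward \<gamma>])
  have "W $ s - ?V $ s \<le> \<gamma> * m + d" for s
    using T[of s] W[of s] by linarith
  then have "m \<le> \<gamma> * m + d" unfolding m_def by (subst Max_le_iff) auto
  then have "m \<le> d / (1 - \<gamma>)" using \<gamma> by (simp add: field_simps)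
  then have "\<gamma> * m \<le> \<gamma> * d / (1 - \<gamma>)" using mult_left_mono[OF _ \<gamma>0] by fastforce
  then show ?thesis using T[of s] by linarith
qed

section \<open>The optimal value function\<close>

lemma value_fun_le_opt_value:
  assumes "\<pi> \<in> policies" and reward: "\<And>s a. r s a \<in> {0..1}" and \<gamma>: "0 < \<gamma>" "\<gamma> < 1"
  shows "value_fun P r \<gamma> \<pi> $ s \<le> opt_value P r \<gamma> $ s"
  unfolding opt_value_def vec_lambda_beta
proof (rule cSUP_upper[OF assms(1)])
  show "bdd_above ((\<lambda>\<pi>. value_fun P r \<gamma> \<pi> $ s) ` policies)"
    using value_fun_le[of r, OF reward \<gamma>] by (intro bdd_aboveI2)
qed

text \<open>One half of the Bellman optimality equation: each policy value is a fixed point of its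
  own operator, which is monotone and dominated by the optimality operator.\<close>

lemma opt_value_le_bellman_opt:
  fixes P :: "'s::finite \<Rightarrow> 'a::finite \<Rightarrow> 's pmf"
  assumes reward: "\<And>s a. r s a \<in> {0..1}" and \<gamma>: "0 < \<gamma>" "\<gamma> < 1"
  shows "opt_value P r \<gamma> $ s \<le> bellman_opt P r \<gamma> (opt_value P r \<gamma>) $ s"
proof -
  have "(SUP \<pi>\<in>policies. value_fun P r \<gamma> \<pi> $ s) \<le> bellman_opt P r \<gamma> (opt_value P r \<gamma>) $ s"
  proof (rule cSUP_least)
    show "(policies :: (real ^ 'a ^ 's) set) \<noteq> {}"
      using ex_bellman_opt_greedy[where 'a = 'a and 's = 's] by blast
    fix \<pi> :: "real ^ 'a ^ 's" assume \<pi>: "\<pi> \<in> policies"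
    have "value_fun P r \<gamma> \<pi> $ s = bellman_policy P r \<gamma> \<pi> (value_fun P r \<gamma> \<pi>) $ s"
      by (simp add: bellman_policy_value_fun[OF \<pi> reward \<gamma>])
    \<comment> \<open>The summand \<open>\<gamma> * 0\<close> makes this the shift lemma with
      \<open>d = 0\<close>, that is, monotonicity.\<close>
    also have "\<dots> \<le> bellman_policy P r \<gamma> \<pi> (opt_value P r \<gamma>) $ s + \<gamma> * 0"
      using value_fun_le_opt_value[of \<pi> r, OF \<pi> reward \<gamma>] \<gamma> by (intro bellman_policy_shift \<pi>) auto
    also have "\<dots> \<le> bellman_opt P r \<gamma> (opt_value P r \<gamma>) $ s"
      using bellman_policy_le_bellman_opt[OF \<pi>] by simp
    finally show "value_fun P r \<gamma> \<pi> $ s \<le> bellman_opt P r \<gamma> (opt_value P r \<gamma>) $ s" .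
  qed
  then show ?thesis by (simp add: opt_value_def[of P r \<gamma>])
qed

lemma le_funpow_bellman_opt:
  fixes P :: "'s::finite \<Rightarrow> 'a::finite \<Rightarrow> 's pmf"
  assumes \<gamma>: "0 \<le> \<gamma>" and le: "\<And>s. V $ s \<le> bellman_opt P r \<gamma> V $ s"
  shows "V $ s \<le> (bellman_opt P r \<gamma> ^^ n) V $ s"
proof (induction n arbitrary: s)
  case (Suc n)
  have "bellman_opt P r \<gamma> V $ s \<le> bellman_opt P r \<gamma> ((bellman_opt P r \<gamma> ^^ n) V) $ s + \<gamma> * 0"
    using Suc by (intro bellman_opt_shift \<gamma>) simp
  then show ?case using le[of s] by simp
qed simp

section \<open>One iteration of h-PMD and the resulting recursion\<close>

lemma opt_value_minus_value_fun_step: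
  fixes P :: "'s::finite \<Rightarrow> 'a::finite \<Rightarrow> 's pmf"
  assumes reward: "\<And>s a. r s a \<in> {0..1}" and \<gamma>: "0 < \<gamma>" "\<gamma> < 1" and h: "h \<ge> 1"
    and \<pi>: "\<pi> \<in> policies" and \<pi>': "\<pi>' \<in> policies"
    and approx: "\<And>s. (bellman_opt P r \<gamma> ^^ h) (value_fun P r \<gamma> \<pi>) $ s \<le>
      bellman_policy P r \<gamma> \<pi>' ((bellman_opt P r \<gamma> ^^ (h - 1)) (value_fun P r \<gamma> \<pi>)) $ s + c"
  shows "infnorm (opt_value P r \<gamma> - value_fun P r \<gamma> \<pi>') \<le>
    \<gamma> ^ h * infnorm (opt_value P r \<gamma> - value_fun P r \<gamma> \<pi>) + c / (1 - \<gamma>)"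
  unfolding infnorm_cart_le_iff
proof
  fix s
  let ?T = "bellman_opt P r \<gamma>" and ?V = "value_fun P r \<gamma> \<pi>" and ?O = "opt_value P r \<gamma>"
  let ?e = "infnorm (?O - ?V)"
  note \<gamma>0 = less_imp_le[OF \<gamma>(1)]
  define W where "W = (?T ^^ (h - 1)) ?V"
  have "?V $ s \<le> ?T ?V $ s" for s
    using bellman_policy_le_bellman_opt[OF \<pi>, of P r \<gamma> ?V s]
    by (simp add: bellman_policy_value_fun[OF \<pi> reward \<gamma>])
  then have "W $ s \<le> (?T ^^ (h - 1)) (?T ?V) $ s + \<gamma> ^ (h - 1) * 0" for s
    unfolding W_def by (intro funpow_bellman_opt_shift \<gamma>0) simp
  \<comment> \<open>Hence \<open>W\<close> is below the \<open>h\<close>-fold iterate of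
    \<open>?V\<close>, which \<open>approx\<close> compares with the new policy's image of
    \<open>W\<close>.\<close>
  moreover have "(?T ^^ (h - 1)) (?T ?V) = (?T ^^ h) ?V"
    using h by (metis Suc_pred' comp_apply funpow_Suc_right less_eq_Suc_le One_nat_def)
  ultimately have "W $ s \<le> bellman_policy P r \<gamma> \<pi>' W $ s + c" for s
    using approx[of s, folded W_def] by (smt (verit) mult_zero_right)
  from bellman_policy_le_value_fun[OF \<pi>' reward \<gamma> this]
  have low: "bellman_policy P r \<gamma> \<pi>' W $ s \<le> value_fun P r \<gamma> \<pi>' $ s + \<gamma> * c / (1 - \<gamma>)" .
  have "?O $ s \<le> (?T ^^ h) ?O $ s"
    by (intro le_funpow_bellman_opt \<gamma>0 opt_value_le_bellman_opt reward \<gamma>)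
  also have "\<dots> \<le> (?T ^^ h) ?V $ s + \<gamma> ^ h * ?e"
  proof (intro funpow_bellman_opt_shift \<gamma>0)
    show "?O $ s \<le> ?V $ s + ?e" for s
      using component_le_infnorm_cart[of "?O - ?V" s] by simp
  qed
  \<comment> \<open>The loss \<open>c\<close> enters once directly through \<open>approx\<close> and
    once discounted through \<open>low\<close>; the two sum to
    \<open>c / (1 - \<gamma>)\<close>.\<close>
  finally have "?O $ s - value_fun P r \<gamma> \<pi>' $ s \<le> \<gamma> ^ h * ?e + (c + \<gamma> * c / (1 - \<gamma>))"
    using approx[of s, folded W_def] low by linarith
  also have "c + \<gamma> * c / (1 - \<gamma>) = c / (1 - \<gamma>)"
    using \<gamma> by (simp add: field_simps)
  \<comment> \<open>Optimality makes the difference nonnegative, so the absolute value needs no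
    second estimate.\<close>
  finally show "\<bar>(?O - value_fun P r \<gamma> \<pi>') $ s\<bar> \<le> \<gamma> ^ h * ?e + c / (1 - \<gamma>)"
    using value_fun_le_opt_value[of \<pi>' r, OF \<pi>' reward \<gamma>, of P s] by simp
qed

text \<open>For each greedy \<open>g\<close>, maximality of \<open>\<pi>'\<close> and nonnegativity
  of its divergence bound \<open>\<eta> * ?gap\<close> by the divergence of \<open>g\<close>. Taking
  the infimum over \<open>g\<close> and using the step size bounds it by \<open>\<eta> * c\<close>,
  and \<open>\<eta>\<close> cancels.\<close>

lemma pmd_step_approximately_greedy:
  fixes P :: "'s::finite \<Rightarrow> 'a::finite \<Rightarrow> 's pmf"
  assumes leg: "legendre_type D \<phi>" "prob_simplex \<subseteq> D" and h: "h \<ge> 1" and \<eta>: "\<eta> > 0" and c: "c > 0"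
    and \<pi>: "\<And>s. \<pi> $ s \<in> rel_interior D"
    and arg_max: "\<And>s. is_arg_max (\<lambda>\<pi>'. pmd_objective P r \<gamma> D \<phi> h \<eta> \<pi> \<pi>' $ s) (\<lambda>\<pi>'. \<pi>' \<in> policies) \<pi>'"
    and step: "\<eta> \<ge> 1 / c *
      infnorm (min_bregman D \<phi> (greedy_policies P r \<gamma> h (value_fun P r \<gamma> \<pi>)) \<pi>)"
  shows "(bellman_opt P r \<gamma> ^^ h) (value_fun P r \<gamma> \<pi>) $ s \<le>
    bellman_policy P r \<gamma> \<pi>' ((bellman_opt P r \<gamma> ^^ (h - 1)) (value_fun P r \<gamma> \<pi>)) $ s + c"
proof -
  let ?V = "value_fun P r \<gamma> \<pi>"
  let ?G = "greedy_policies P r \<gamma> h ?V"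
  let ?W = "(bellman_opt P r \<gamma> ^^ (h - 1)) ?V"
  let ?gap = "(bellman_opt P r \<gamma> ^^ h) ?V $ s - bellman_policy P r \<gamma> \<pi>' ?W $ s"
  have \<pi>': "\<pi>' \<in> policies" using arg_max by (simp add: is_arg_max_def)
  have "\<eta> * ?gap \<le> bregman_policy D \<phi> g \<pi> $ s" if g: "g \<in> ?G" for g
  proof -
    have "g \<in> policies" and Tg: "bellman_policy P r \<gamma> g ?W = (bellman_opt P r \<gamma> ^^ h) ?V"
      using g by (auto simp: greedy_policies_def)
    then have "pmd_objective P r \<gamma> D \<phi> h \<eta> \<pi> g $ s \<le> pmd_objective P r \<gamma> D \<phi> h \<eta> \<pi> \<pi>' $ s"
      using arg_max[of s] by (auto simp: is_arg_max_def not_less)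
    moreover have "0 \<le> bregman_policy D \<phi> \<pi>' \<pi> $ s"
      using bregman_nonneg[OF leg(1) _ \<pi>] \<pi>' leg(2) by (auto simp: bregman_policy_def policies_def)
    ultimately show ?thesis
      using Tg by (simp add: pmd_objective_def algebra_simps)
  qed
  then have "\<eta> * ?gap \<le> min_bregman D \<phi> ?G \<pi> $ s"
    unfolding min_bregman_def vec_lambda_beta
    using greedy_policies_nonempty[OF h] by (intro cINF_greatest)
  also have "\<dots> \<le> infnorm (min_bregman D \<phi> ?G \<pi>)"
    using component_le_infnorm_cart[of "min_bregman D \<phi> ?G \<pi>" s] by simp
  also have "\<dots> \<le> \<eta> * c"
    using step c by (simp add: field_simps)
  finally have "?gap \<le> c" using \<eta> by simp
  then show ?thesis by simp
qed

text \<open>After division by \<open>\<gamma> ^ (h * k)\<close> the recursion telescopes, with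
  increments at most \<open>b * c k / \<gamma> ^ (h * Suc k)\<close>.\<close>

lemma geometric_recursion_bound:
  fixes e c :: "nat \<Rightarrow> real"
  assumes \<gamma>: "0 < \<gamma>" and step: "\<And>k. e (Suc k) \<le> \<gamma> ^ h * e k + b * c k"
  shows "e k \<le> \<gamma> ^ (h * k) * (e 0 + b * (\<Sum>t=1..k. c (t - 1) / \<gamma> ^ (h * t)))"
proof (induction k)
  case (Suc k)
  let ?S = "\<lambda>k. \<Sum>t=1..k. c (t - 1) / \<gamma> ^ (h * t)"
  have "e (Suc k) \<le> \<gamma> ^ h * (\<gamma> ^ (h * k) * (e 0 + b * ?S k)) + b * c k"
    using \<gamma> by (intro order_trans[OF step] add_right_mono mult_left_mono Suc) simp
  also have "\<dots> = \<gamma> ^ (h * Suc k) * (e 0 + b * (?S k + c k / \<gamma> ^ (h * Suc k)))"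
    using \<gamma> by (simp add: power_add field_simps)
  \<comment> \<open>The new summand has index \<open>t = Suc k\<close> and carries
    \<open>c k\<close>, whence \<open>c (t - 1)\<close> in the sum.\<close>
  also have "?S k + c k / \<gamma> ^ (h * Suc k) = ?S (Suc k)" by simp
  finally show ?case .
qed simp

theorem theorem4p1:
  fixes P :: "'s::finite \<Rightarrow> 'a::finite \<Rightarrow> 's pmf"
    and r :: "'s \<Rightarrow> 'a \<Rightarrow> real"
    and \<gamma> :: real
    and D :: "(real ^ 'a) set"
    and \<phi> :: "real ^ 'a \<Rightarrow> real"
    and h :: nat
    and c \<eta> :: "nat \<Rightarrow> real"
    and \<pi> :: "nat \<Rightarrow> real ^ 'a ^ 's"
  assumes reward: "\<And>s a. r s a \<in> {0..1}"
    and discount: "0 < \<gamma>" "\<gamma> < 1"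
    and mirror_map: "legendre_type D \<phi>" "prob_simplex \<subseteq> D"
    and lookahead: "h \<ge> 1"
    and c_pos: "\<And>k. c k > 0"
    and init: "\<pi> 0 \<in> rel_interior policies"
    and generated: "generated_by_h_pmd P r \<gamma> D \<phi> h \<eta> \<pi>"
    and step_pos: "\<And>k. \<eta> k > 0"
    and step_size: "\<And>k. \<eta> k \<ge> 1 / c k *
        infnorm (min_bregman D \<phi> (greedy_policies P r \<gamma> h (value_fun P r \<gamma> (\<pi> k))) (\<pi> k))"
  shows "\<forall>k. infnorm (opt_value P r \<gamma> - value_fun P r \<gamma> (\<pi> k))
           \<le> \<gamma> ^ (h * k) *
              (infnorm (opt_value P r \<gamma> - value_fun P r \<gamma> (\<pi> 0))
                + 1 / (1 - \<gamma>) * (\<Sum>t=1..k. c (t - 1) / \<gamma> ^ (h * t)))"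
proof
  fix k
  have ri: "\<pi> k $ s \<in> rel_interior D"
    and arg_max: "is_arg_max (\<lambda>\<pi>'. pmd_objective P r \<gamma> D \<phi> h (\<eta> k) (\<pi> k) \<pi>' $ s)
      (\<lambda>\<pi>'. \<pi>' \<in> policies) (\<pi> (Suc k))" for k s
    using generated by (auto simp: generated_by_h_pmd_def)
  \<comment> \<open>The start is a policy by \<open>init\<close>, every later iterate by feasibility
    of the maximiser.\<close>
  have policy: "\<pi> k \<in> policies" for k
  proof (cases k)
    case 0
    then show ?thesis using init rel_interior_subset by blast
  next
    case (Suc j)
    then show ?thesis using arg_max[of j] by (simp add: is_arg_max_def)
  qed
  have approx: "(bellman_opt P r \<gamma> ^^ h) (value_fun P r \<gamma> (\<pi> k)) $ s \<le>
      bellman_policy P r \<gamma> (\<pi> (Suc k)) ((bellman_opt P r \<gamma> ^^ (h - 1)) (value_fun P r \<gamma> (\<pi> k))) $ s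
        + c k" for k s
    by (rule pmd_step_approximately_greedy[OF mirror_map lookahead step_pos c_pos ri arg_max step_size])
  have "infnorm (opt_value P r \<gamma> - value_fun P r \<gamma> (\<pi> (Suc k))) \<le>
      \<gamma> ^ h * infnorm (opt_value P r \<gamma> - value_fun P r \<gamma> (\<pi> k)) + 1 / (1 - \<gamma>) * c k" for k
    using opt_value_minus_value_fun_step[OF reward discount lookahead policy policy approx] by simp
  from geometric_recursion_bound[where e = "\<lambda>k. infnorm (opt_value P r \<gamma> - value_fun P r \<gamma> (\<pi> k))",
      OF discount(1) this]
  show "infnorm (opt_value P r \<gamma> - value_fun P r \<gamma> (\<pi> k)) \<le> \<gamma> ^ (h * k) *
      (infnorm (opt_value P r \<gamma> - value_fun P r \<gamma> (\<pi> 0))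
        + 1 / (1 - \<gamma>) * (\<Sum>t=1..k. c (t - 1) / \<gamma> ^ (h * t)))" .
qed

end
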